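(* Let $L_0=P_0$ and, for $k\ge1$, $$L_k=\Big(L_{k|k-1}^{-1}+\sum_{i=1}^m p_{k,i}\frac{C_i'C_i}{r_i}\Big)^{-1},\qquad L_{k|k-1}=AL_{k-1}A'+Q .$$ Then $\mathbb E P_k\ge L_k$ for all $k\ge 0$, where $\ge$ is the Loewner (positive semidefinite) order.
   Context: Data: $A\in\mathbb R^{n\times n}$; $Q,\Sigma\in\mathbb R^{n\times n}$ symmetric positive definite; row vectors $C_1,\dots,C_m\in\mathbb R^{1\times n}$ with $C=[C_1',\dots,C_m']'$ (prime denotes transpose) and $(C,A)$ observable; variances $r_1,\dots,r_m>0$. Network: a directed tree $G$ with vertex set $\{s_0,s_1,\dots,s_m\}$ (fusion center $s_0$, sensors $s_1,\dots,s_m$), where each sensor has exactly one outgoing edge (to its parent) and a unique directed path to $s_0$. $\mathcal T$ is the finite set of all subtrees $T=(V_T,E_T)$ of $G$ containing $s_0$. At each time $k\ge1$ one tree is randomly selected from $\mathcal T$, tree $T$ being selected with probability $\pi_{k,T}$ (where $\pi_{k,T}\ge0$, $\sum_{T\in\mathcal T}\pi_{k,T}=1$). Let $p_{k,i}=\sum_{T\in\mathcal T,\ s_i\in V_T}\pi_{k,T}$ be the marginal probability that sensor $s_i$ is selected at time $k$. The estimation error covariance of the Kalman filter is the random matrix sequence defined by $P_0=\Sigma$ and, if $T$ is the tree selected at time $k$, $$P_k=\Big(P_{k|k-1}^{-1}+\sum_{s_i\in V_T,\ s_i\neq s_0}\frac{C_i'C_i}{r_i}\Big)^{-1},\qquad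 P_{k|k-1}=AP_{k-1}A'+Q .$$ *)

theory Defs
  imports "HOL-Probability.Probability" "Graph_Theory.Digraph_Component"
begin

section \<open>Matrices and the Loewner order\<close>

definition pos_def :: "real^'n^'n \<Rightarrow> bool" where
  "pos_def X \<longleftrightarrow> transpose X = X \<and> (\<forall>x. x \<noteq> 0 \<longrightarrow> 0 < x \<bullet> (X *v x))"

definition pos_semidef :: "real^'n^'n \<Rightarrow> bool" where
  "pos_semidef X \<longleftrightarrow> transpose X = X \<and> (\<forall>x. 0 \<le> x \<bullet> (X *v x))"

definition loewner_le :: "real^'n^'n \<Rightarrow> real^'n^'n \<Rightarrow> bool" (infix \<open>\<preceq>\<^sub>L\<close> 50) where
  "X \<preceq>\<^sub>L Y \<longleftrightarrow> pos_semidef (Y - X)"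

text \<open>
  Rank condition: the stacked matrix with block rows \<open>C, CA, \<dots>, CA\<^sup>n\<^sup>-\<^sup>1\<close> has rank \<open>n\<close>.
  As in \<open>rank\<close>, this is the dimension of the span of its rows.
\<close>
definition observable :: "real^'n^'m \<Rightarrow> real^'n^'n \<Rightarrow> bool" where
  "observable C A \<longleftrightarrow>
     dim {row i (((\<lambda>X. X ** A) ^^ k) C) | i k. k < CARD('n)} = CARD('n)"

section \<open>The sensor network\<close>

text \<open>The sensors are indexed by a finite type, whose cardinality is the number of sensors.\<close>
datatype 'm node = Fusion_Center | Sensor 'm

text \<open>
  A directed tree is an orientation of an undirected tree. The predicate \<open>tree\<close> of the graph
  library only excludes directed cycles, so acyclicity is imposed here on the underlying undirected
  graph. In the symmetric closure, a cycle of length two runs back and forth along one edge and is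
  not a cycle of the undirected graph.
\<close>
definition directed_tree :: "'v pair_pre_digraph \<Rightarrow> bool" where
  "directed_tree G \<longleftrightarrow>
     pair_digraph G \<and> asym (parcs G) \<and> Digraph_Component.connected (with_proj G) \<and>
     \<not> (\<exists>c. pre_digraph.cycle (mk_symmetric (with_proj G)) c \<and> 2 < length c)"

definition sensor_tree :: "'m node pair_pre_digraph \<Rightarrow> bool" where
  "sensor_tree G \<longleftrightarrow>
     directed_tree G \<and> pverts G = UNIV \<and>
     (\<forall>i. out_degree (with_proj G) (Sensor i) = 1 \<and>
          (\<exists>!q. pre_digraph.apath (with_proj G) (Sensor i) q Fusion_Center))"

definition fc_subtrees :: "'m node pair_pre_digraph \<Rightarrow> 'm node pair_pre_digraph set" where
  "fc_subtrees G =
     {T. subgraph (with_proj T) (with_proj G) \<and> directed_tree T \<and> Fusion_Center \<in> pverts T}"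

lemma finite_fc_subtrees:
  fixes G :: "'m::finite node pair_pre_digraph"
  shows "finite (fc_subtrees G)"
proof -
  have UNIV_node: "(UNIV :: 'm node set) = insert Fusion_Center (range Sensor)"
    by (auto intro: node.exhaust)
  have fin: "finite (UNIV :: 'm node set)"
    unfolding UNIV_node by simp
  have "inj (\<lambda>T :: 'm node pair_pre_digraph. (pverts T, parcs T))"
    by (auto simp: inj_def)
  moreover have "finite (UNIV :: ('m node set \<times> 'm node rel) set)"
    using fin by (simp add: finite_prod Finite_Set.finite_set)
  ultimately have "finite (UNIV :: 'm node pair_pre_digraph set)"
    by (metis finite_imageD finite_subset subset_UNIV)
  then show ?thesis
    by (metis finite_subset subset_UNIV)
qed

definition selection_prob ::
  "'m node pair_pre_digraph \<Rightarrow> (nat \<Rightarrow> 'm node pair_pre_digraph \<Rightarrow> real) \<Rightarrow> nat \<Rightarrow> 'm \<Rightarrow> real" where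
  "selection_prob G \<pi> k i = (\<Sum>T \<in> {T \<in> fc_subtrees G. Sensor i \<in> pverts T}. \<pi> k T)"

section \<open>Covariance recursions\<close>

text \<open>The constraint is needed: \<open>rowvector\<close> is polymorphic in the number of rows.\<close>
definition sensor_info :: "real^'n^'m \<Rightarrow> ('m \<Rightarrow> real) \<Rightarrow> 'm \<Rightarrow> real^'n^'n" where
  "sensor_info C r i =
     (transpose (rowvector (row i C) :: real^'n^1) ** rowvector (row i C)) /\<^sub>R r i"

text \<open>
  Information-form Riccati recursion, where \<open>J k\<close> is the information gained at time \<open>k \<ge> 1\<close>;
  \<open>J 0\<close> is not used.
\<close>
primrec riccati :: "real^'n^'n \<Rightarrow> real^'n^'n \<Rightarrow> real^'n^'n \<Rightarrow> (nat \<Rightarrow> real^'n^'n) \<Rightarrow> nat \<Rightarrow> real^'n^'n"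
where
  "riccati A Q S J 0 = S"
| "riccati A Q S J (Suc k) =
     matrix_inv (matrix_inv (A ** riccati A Q S J k ** transpose A + Q) + J (Suc k))"

definition error_cov ::
  "real^'n^'n \<Rightarrow> real^'n^'n \<Rightarrow> real^'n^'n \<Rightarrow> real^'n^'m \<Rightarrow> ('m::finite \<Rightarrow> real) \<Rightarrow>
   (nat \<Rightarrow> 'm node pair_pre_digraph) \<Rightarrow> nat \<Rightarrow> real^'n^'n" where
  "error_cov A Q S C r T =
     riccati A Q S (\<lambda>k. \<Sum>i \<in> {i. Sensor i \<in> pverts (T k)}. sensor_info C r i)"

definition lower_cov ::
  "real^'n^'n \<Rightarrow> real^'n^'n \<Rightarrow> real^'n^'n \<Rightarrow> real^'n^'m \<Rightarrow> ('m::finite \<Rightarrow> real) \<Rightarrow>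
   (nat \<Rightarrow> 'm \<Rightarrow> real) \<Rightarrow> nat \<Rightarrow> real^'n^'n" where
  "lower_cov A Q S C r p = riccati A Q S (\<lambda>k. \<Sum>i\<in>UNIV. p k i *\<^sub>R sensor_info C r i)"

end

theory Submission
  imports Defs
begin

text \<open>
  The proof passes from covariances to information matrices \<open>Y\<^sub>k = P\<^sub>k\<inverse>\<close>, where the recursion reads
  \<open>Y\<^sub>k = (A Y\<^sub>k\<^sub>-\<^sub>1\<inverse> A' + Q)\<inverse> + J\<^sub>k\<close>, with \<open>J\<^sub>k\<close> the information gained at time \<open>k\<close>. The random information
  now enters additively, and the prediction map is concave and monotone in \<open>Y\<close> because its quadratic
  form is a minimum of affine increasing functions,
  \<open>x'(A Y\<inverse> A' + Q)\<inverse>x = min\<^sub>v ((x - Av)'Q\<inverse>(x - Av) + v'Yv)\<close>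
  (\<open>predicted_info_le\<close>, \<open>predicted_info_attained\<close>). Taking expectations, Jensen's inequality and
  induction on \<open>k\<close> give \<open>E Y\<^sub>k \<le> L\<^sub>k\<inverse>\<close> (\<open>expected_info_le\<close>), where \<open>L\<^sub>k\<close> is the recursion driven by
  \<open>E J\<^sub>k\<close>. As inversion is operator convex and antitone, \<open>E P\<^sub>k \<ge> (E Y\<^sub>k)\<inverse> \<ge> L\<^sub>k\<close>
  (\<open>riccati_mean_le_expectation\<close>). The tree enters only through \<open>E J\<^sub>k\<close>, which is linear in the marginal
  selection probabilities (\<open>expected_tree_info\<close>), so the trees of different times may depend on
  each other.

  Both Jensen steps are carried out on quadratic forms with a fixed trial vector, and both variational
  formulas come from the single inequality \<open>2v'x - v'Yv \<le> x'Y\<inverse>x\<close> (\<open>inverse_form_ge\<close>). All random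
  matrices take finitely many values, since there are finitely many trees, so they are integrable.
\<close>

section \<open>Positive definite matrices\<close>

lemma pos_def_imp_pos_semidef: "pos_def X \<Longrightarrow> pos_semidef X"
  unfolding pos_def_def pos_semidef_def
  by (metis inner_zero_left order_less_imp_le order_refl)

lemma symmetric_matrix_inner:
  fixes X :: "real^'n^'n"
  assumes "transpose X = X"
  shows "x \<bullet> (X *v y) = y \<bullet> (X *v x)"
  by (metis assms dot_lmul_matrix inner_commute transpose_matrix_vector)

lemma matrix_inv_mult:
  fixes X :: "'a::semiring_1^'n^'m"
  assumes "invertible X"
  shows "X ** matrix_inv X = mat 1" and "matrix_inv X ** X = mat 1"
  using someI_ex[OF assms[unfolded invertible_def]] unfolding matrix_inv_def by auto

lemma matrix_inv_eqI:
  fixes X Y :: "real^'n^'n"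
  assumes "X ** Y = mat 1"
  shows "matrix_inv X = Y"
proof -
  have YX: "Y ** X = mat 1"
    using assms by (simp add: matrix_left_right_inverse)
  have inv: "invertible X"
    unfolding invertible_def using assms YX by blast
  have "matrix_inv X = (Y ** X) ** matrix_inv X"
    by (simp add: YX)
  also have "\<dots> = Y ** (X ** matrix_inv X)"
    by (simp add: matrix_mul_assoc)
  finally show ?thesis
    by (simp add: matrix_inv_mult(1)[OF inv])
qed

lemma pos_def_invertible:
  assumes "pos_def X"
  shows "invertible X"
proof -
  have "x = 0" if "X *v x = 0" for x
    using assms that unfolding pos_def_def by (metis inner_zero_right less_irrefl)
  then show ?thesis
    unfolding invertible_left_inverse matrix_left_invertible_ker by blast
qed

lemma pos_def_inv_cancel:
  assumes "pos_def X"
  shows "X *v (matrix_inv X *v x) = x" and "matrix_inv X *v (X *v x) = x"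
  using matrix_inv_mult[OF pos_def_invertible[OF assms]]
  by (simp_all add: matrix_vector_mul_assoc)

lemma matrix_inv_matrix_inv:
  assumes "pos_def X"
  shows "matrix_inv (matrix_inv X) = X"
  by (rule matrix_inv_eqI) (rule matrix_inv_mult(2)[OF pos_def_invertible[OF assms]])

lemma pos_def_matrix_inv:
  fixes X :: "real^'n^'n"
  assumes "pos_def X"
  shows "pos_def (matrix_inv X)"
proof -
  have inv: "X ** matrix_inv X = mat 1" "matrix_inv X ** X = mat 1"
    using matrix_inv_mult[OF pos_def_invertible[OF assms]] by auto
  have symX: "transpose X = X"
    using assms by (simp add: pos_def_def)
  have "X ** transpose (matrix_inv X) = transpose (matrix_inv X ** X)"
    by (simp add: matrix_transpose_mul symX)
  then have "X ** transpose (matrix_inv X) = mat 1"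
    by (simp add: inv transpose_mat)
  then have "transpose (matrix_inv X) = matrix_inv X"
    by (metis matrix_inv_eqI)
  moreover have "0 < x \<bullet> (matrix_inv X *v x)" if "x \<noteq> 0" for x
  proof -
    define y where "y = matrix_inv X *v x"
    have x: "x = X *v y"
      by (simp add: y_def pos_def_inv_cancel[OF assms])
    have "y \<noteq> 0"
      using that x by auto
    then have "0 < y \<bullet> (X *v y)"
      using assms by (simp add: pos_def_def)
    also have "y \<bullet> (X *v y) = x \<bullet> (matrix_inv X *v x)"
      unfolding x[symmetric] y_def[symmetric] by (rule inner_commute)
    finally show ?thesis .
  qed
  ultimately show ?thesis
    by (simp add: pos_def_def)
qed

lemma pos_def_add:
  assumes "pos_def X" and "pos_semidef Y"
  shows "pos_def (X + Y)"
proof -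
  have "transpose (X + Y) = transpose X + transpose Y"
    by (simp add: transpose_def vec_eq_iff)
  then show ?thesis
    using assms unfolding pos_def_def pos_semidef_def
    by (simp add: matrix_vector_mult_add_rdistrib inner_add_right add_pos_nonneg)
qed

lemma inner_congruence:
  fixes A P :: "real^'n^'n"
  shows "x \<bullet> ((A ** P ** transpose A) *v y) = (x v* A) \<bullet> (P *v (y v* A))"
  by (simp add: matrix_vector_mul_assoc[symmetric] dot_lmul_matrix)

lemma pos_semidef_congruence:
  fixes A P :: "real^'n^'n"
  assumes "pos_semidef P"
  shows "pos_semidef (A ** P ** transpose A)"
  using assms unfolding pos_semidef_def inner_congruence
  by (simp add: matrix_transpose_mul matrix_mul_assoc)

lemma pos_def_prediction:
  fixes A P Q :: "real^'n^'n"
  assumes "pos_def P" and "pos_def Q"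
  shows "pos_def (A ** P ** transpose A + Q)"
  using pos_def_add[OF assms(2) pos_semidef_congruence[OF pos_def_imp_pos_semidef[OF assms(1)]]]
  by (simp add: add.commute)

lemma pos_semidef_sum:
  assumes "\<And>i. i \<in> I \<Longrightarrow> pos_semidef (F i)"
  shows "pos_semidef (\<Sum>i\<in>I. F i)"
proof -
  have "transpose (\<Sum>i\<in>I. F i) = (\<Sum>i\<in>I. transpose (F i))"
    by (simp add: transpose_def vec_eq_iff)
  moreover have "x \<bullet> ((\<Sum>i\<in>I. F i) *v x) = (\<Sum>i\<in>I. x \<bullet> (F i *v x))" for x
    by (induction I rule: infinite_finite_induct)
       (simp_all add: matrix_vector_mult_add_rdistrib inner_add_right)
  ultimately show ?thesis
    using assms by (auto simp: pos_semidef_def intro: sum_nonneg)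
qed

lemma pos_semidef_sensor_info:
  fixes C :: "real^'n^'m"
  assumes "r i > 0"
  shows "pos_semidef (sensor_info C r i)"
proof -
  define R :: "real^'n^1" where "R = rowvector (row i C)"
  have info: "sensor_info C r i = (transpose R ** R) /\<^sub>R r i"
    by (simp add: sensor_info_def R_def)
  have "transpose (sensor_info C r i) = sensor_info C r i"
    unfolding info by (simp add: transpose_scalar matrix_transpose_mul)
  moreover have "0 \<le> x \<bullet> (sensor_info C r i *v x)" for x
  proof -
    have "x \<bullet> ((transpose R ** R) *v x) = ((R *v x) v* R) \<bullet> x"
      by (simp add: matrix_vector_mul_assoc[symmetric] inner_commute)
    also have "\<dots> = (R *v x) \<bullet> (R *v x)"
      by (rule dot_lmul_matrix)
    finally show ?thesis
      using assms unfolding info by (simp add: scaleR_matrix_vector_assoc[symmetric])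
  qed
  ultimately show ?thesis
    by (simp add: pos_semidef_def)
qed

section \<open>Variational formulas for the matrix inverse\<close>

text \<open>
  Expand \<open>0 \<le> (v - Y\<inverse>x)'Y(v - Y\<inverse>x)\<close>. This is half of the Legendre duality between the forms
  of \<open>Y\<close> and \<open>Y\<inverse>\<close>; the bound is attained at \<open>v = Y\<inverse>x\<close>. It replaces the operator convexity of
  inversion, because the left-hand side is affine in \<open>Y\<close>.
\<close>
lemma inverse_form_ge:
  fixes Y :: "real^'n^'n"
  assumes "pos_def Y"
  shows "2 * (v \<bullet> x) - v \<bullet> (Y *v v) \<le> x \<bullet> (matrix_inv Y *v x)"
proof -
  define z where "z = matrix_inv Y *v x"
  have x: "x = Y *v z"
    by (simp add: z_def pos_def_inv_cancel[OF assms])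
  have "0 \<le> (v - z) \<bullet> (Y *v (v - z))"
    using pos_def_imp_pos_semidef[OF assms] by (simp add: pos_semidef_def)
  also have "\<dots> = v \<bullet> (Y *v v) - 2 * (v \<bullet> (Y *v z)) + z \<bullet> (Y *v z)"
    using symmetric_matrix_inner[of Y v z] assms
    by (simp add: pos_def_def matrix_vector_mult_diff_distrib inner_diff_left inner_diff_right)
  finally have "2 * (v \<bullet> x) - v \<bullet> (Y *v v) \<le> x \<bullet> z"
    using x by (simp add: inner_commute)
  then show ?thesis
    by (simp add: z_def)
qed

text \<open>
  The information form of the prediction step is a minimum over \<open>v\<close> of functions that are affine
  and increasing in \<open>P\<inverse>\<close>, which is what makes \<open>P\<inverse> \<mapsto> (A P A' + Q)\<inverse>\<close> concave and monotone. Both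
  summands on the right are bounded below by duality, tested against the same vector
  \<open>z = (A P A' + Q)\<inverse> x\<close>.
\<close>
lemma predicted_info_le:
  fixes A P Q :: "real^'n^'n"
  assumes P: "pos_def P" and Q: "pos_def Q"
  shows "x \<bullet> (matrix_inv (A ** P ** transpose A + Q) *v x)
    \<le> (x - A *v v) \<bullet> (matrix_inv Q *v (x - A *v v)) + v \<bullet> (matrix_inv P *v v)"
proof -
  define S where "S = A ** P ** transpose A + Q"
  define z where "z = matrix_inv S *v x"
  have S: "pos_def S"
    unfolding S_def by (rule pos_def_prediction[OF P Q])
  have x: "S *v z = x"
    by (simp add: z_def pos_def_inv_cancel[OF S])
  have "2 * (z \<bullet> (x - A *v v)) - z \<bullet> (Q *v z)
      \<le> (x - A *v v) \<bullet> (matrix_inv Q *v (x - A *v v))"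
    by (rule inverse_form_ge[OF Q])
  moreover have "2 * ((z v* A) \<bullet> v) - (z v* A) \<bullet> (P *v (z v* A))
      \<le> v \<bullet> (matrix_inv P *v v)"
    by (rule inverse_form_ge[OF P])
  moreover have "(z v* A) \<bullet> v = z \<bullet> (A *v v)"
    by (rule dot_lmul_matrix)
  moreover have "z \<bullet> (S *v z)
      = (z v* A) \<bullet> (P *v (z v* A)) + z \<bullet> (Q *v z)"
    by (simp add: S_def matrix_vector_mult_add_rdistrib inner_add_right inner_congruence)
  ultimately have "z \<bullet> x \<le> (x - A *v v) \<bullet> (matrix_inv Q *v (x - A *v v)) + v \<bullet> (matrix_inv P *v v)"
    by (simp add: x inner_diff_right)
  then show ?thesis
    by (simp add: z_def S_def inner_commute)
qed

lemma predicted_info_attained: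
  fixes A P Q :: "real^'n^'n"
  assumes P: "pos_def P" and Q: "pos_def Q"
  obtains v where "x \<bullet> (matrix_inv (A ** P ** transpose A + Q) *v x)
    = (x - A *v v) \<bullet> (matrix_inv Q *v (x - A *v v)) + v \<bullet> (matrix_inv P *v v)"
proof
  define S where "S = A ** P ** transpose A + Q"
  define z where "z = matrix_inv S *v x"
  define v where "v = P *v (z v* A)"
  have S: "pos_def S"
    unfolding S_def by (rule pos_def_prediction[OF P Q])
  have "x = S *v z"
    by (simp add: z_def pos_def_inv_cancel[OF S])
  also have "\<dots> = A *v v + Q *v z"
    by (simp add: S_def v_def matrix_vector_mult_add_rdistrib matrix_vector_mul_assoc[symmetric])
  finally have x: "x = A *v v + Q *v z" .
  have "x \<bullet> (matrix_inv S *v x) = (A *v v) \<bullet> z + (Q *v z) \<bullet> z"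
    unfolding z_def[symmetric] by (subst x) (simp add: inner_add_left)
  moreover have "(A *v v) \<bullet> z = v \<bullet> (z v* A)"
    using dot_lmul_matrix[of z A v] by (simp add: inner_commute)
  moreover have "x - A *v v = Q *v z"
    by (subst x) simp
  ultimately show "x \<bullet> (matrix_inv (A ** P ** transpose A + Q) *v x)
    = (x - A *v v) \<bullet> (matrix_inv Q *v (x - A *v v)) + v \<bullet> (matrix_inv P *v v)"
    by (simp add: S_def v_def pos_def_inv_cancel[OF P] pos_def_inv_cancel[OF Q])
qed

section \<open>The Riccati recursion in information form\<close>

lemma pos_def_riccati:
  assumes "pos_def Q" and "pos_def S" and "\<And>k. k \<ge> 1 \<Longrightarrow> pos_semidef (J k)"
  shows "pos_def (riccati A Q S J k)"
  using assms
  by (induction k) (auto intro!: pos_def_matrix_inv pos_def_add pos_def_prediction)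

lemma matrix_inv_riccati_Suc:
  assumes "pos_def Q" and "pos_def S" and "\<And>k. k \<ge> 1 \<Longrightarrow> pos_semidef (J k)"
  shows "matrix_inv (riccati A Q S J (Suc k))
    = matrix_inv (A ** riccati A Q S J k ** transpose A + Q) + J (Suc k)"
  using assms
  by (auto intro!: matrix_inv_matrix_inv pos_def_add pos_def_matrix_inv pos_def_prediction
      pos_def_riccati)

section \<open>Expectations of random matrices\<close>

lemma (in finite_measure) integrable_simple_function:
  fixes f :: "'a \<Rightarrow> 'b::{banach, second_countable_topology}"
  assumes "simple_function M f"
  shows "integrable M f"
proof (rule integrable_const_bound)
  show "f \<in> borel_measurable M"
    by (rule borel_measurable_simple_function[OF assms])
  have "finite (norm ` f ` space M)"
    using simple_functionD(1)[OF assms] by simp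
  then show "AE \<omega> in M. norm (f \<omega>) \<le> Max (norm ` f ` space M)"
    by (intro AE_I2 Max_ge) auto
qed

lemma bounded_linear_matrix_form:
  fixes x y :: "real^'n"
  shows "bounded_linear (\<lambda>X::real^'n^'n. x \<bullet> (X *v y))"
  unfolding linear_conv_bounded_linear[symmetric]
  by (rule linearI)
     (simp_all add: matrix_vector_mult_add_rdistrib inner_add_right
       scaleR_matrix_vector_assoc[symmetric])

lemma bounded_linear_transpose: "bounded_linear (transpose :: real^'n^'n \<Rightarrow> real^'n^'n)"
  unfolding linear_conv_bounded_linear[symmetric]
  by (rule linearI) (simp_all add: transpose_def vec_eq_iff)

lemma integrable_matrix_form:
  fixes X :: "'w \<Rightarrow> real^'n^'n"
  assumes "integrable M X"
  shows "integrable M (\<lambda>\<omega>. x \<bullet> (X \<omega> *v y))"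
  by (rule integrable_bounded_linear[OF bounded_linear_matrix_form assms])

lemma integral_matrix_form:
  fixes X :: "'w \<Rightarrow> real^'n^'n"
  assumes "integrable M X"
  shows "x \<bullet> ((LINT \<omega>|M. X \<omega>) *v y) = (LINT \<omega>|M. x \<bullet> (X \<omega> *v y))"
  by (rule integral_bounded_linear[OF bounded_linear_matrix_form assms, symmetric])

lemma transpose_integral:
  fixes X :: "'w \<Rightarrow> real^'n^'n"
  assumes "integrable M X" and "\<And>\<omega>. \<omega> \<in> space M \<Longrightarrow> transpose (X \<omega>) = X \<omega>"
  shows "transpose (LINT \<omega>|M. X \<omega>) = (LINT \<omega>|M. X \<omega>)"
proof -
  have "transpose (LINT \<omega>|M. X \<omega>) = (LINT \<omega>|M. transpose (X \<omega>))"
    by (rule integral_bounded_linear[OF bounded_linear_transpose assms(1), symmetric])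
  also have "\<dots> = (LINT \<omega>|M. X \<omega>)"
    by (rule Bochner_Integration.integral_cong) (simp_all add: assms(2))
  finally show ?thesis .
qed

lemma pos_semidef_integral:
  fixes X :: "'w \<Rightarrow> real^'n^'n"
  assumes "integrable M X" and "\<And>\<omega>. \<omega> \<in> space M \<Longrightarrow> pos_semidef (X \<omega>)"
  shows "pos_semidef (LINT \<omega>|M. X \<omega>)"
  using assms unfolding pos_semidef_def
  by (auto simp: integral_matrix_form intro!: transpose_integral Bochner_Integration.integral_nonneg)

section \<open>Replacing random information by its mean\<close>

lemma simple_function_riccati:
  assumes "\<And>k. k \<ge> 1 \<Longrightarrow> simple_function M (J k)"
  shows "simple_function M (\<lambda>\<omega>. riccati A Q S (\<lambda>j. J j \<omega>) k)"
proof (induction k)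
  case (Suc k)
  have "simple_function M (J (Suc k))"
    by (rule assms) simp
  from simple_function_compose2[OF Suc this,
      of "\<lambda>P N. matrix_inv (matrix_inv (A ** P ** transpose A + Q) + N)"]
  show ?case
    by simp
qed simp

text \<open>
  The induction runs on information matrices rather than covariances: one step of the covariance
  recursion is not jointly convex in the covariance and the new information, whereas in information
  form the new information enters additively and the prediction step is concave. Hence only the mean
  of each \<open>J k\<close> matters, not their joint distribution.
\<close>
lemma expected_info_le:
  fixes J :: "nat \<Rightarrow> 'w \<Rightarrow> real^'n^'n"
  assumes "prob_space M" and Q: "pos_def Q" and S: "pos_def S"
    and simple: "\<And>k. k \<ge> 1 \<Longrightarrow> simple_function M (J k)"
    and psd: "\<And>k \<omega>. k \<ge> 1 \<Longrightarrow> \<omega> \<in> space M \<Longrightarrow> pos_semidef (J k \<omega>)"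
  shows "(LINT \<omega>|M. x \<bullet> (matrix_inv (riccati A Q S (\<lambda>j. J j \<omega>) k) *v x))
    \<le> x \<bullet> (matrix_inv (riccati A Q S (\<lambda>j. LINT \<omega>|M. J j \<omega>) k) *v x)"
proof -
  interpret prob_space M by fact
  define P where "P k \<omega> = riccati A Q S (\<lambda>j. J j \<omega>) k" for k \<omega>
  define L where "L = riccati A Q S (\<lambda>j. LINT \<omega>|M. J j \<omega>)"
  define pred where "pred X = matrix_inv (A ** X ** transpose A + Q)" for X
  have J_int: "integrable M (J k)" if "k \<ge> 1" for k
    using integrable_simple_function[OF simple[OF that]] .
  have mean_psd: "pos_semidef (LINT \<omega>|M. J k \<omega>)" if "k \<ge> 1" for k
    using pos_semidef_integral[OF J_int[OF that]] psd[OF that] by blast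
  have L_pd: "pos_def (L k)" for k
    unfolding L_def by (rule pos_def_riccati[OF Q S mean_psd])
  have P_pd: "pos_def (P k \<omega>)" if "\<omega> \<in> space M" for k \<omega>
    unfolding P_def using that by (intro pos_def_riccati[OF Q S] psd)
  have P_simple: "simple_function M (P k)" for k
    unfolding P_def by (rule simple_function_riccati[OF simple])
  have form_int: "integrable M (\<lambda>\<omega>. y \<bullet> (f (P k \<omega>) *v y))" for f :: "real^'n^'n \<Rightarrow> real^'n^'n" and k y
    by (intro integrable_matrix_form integrable_simple_function simple_function_compose1[OF P_simple])
  have "(LINT \<omega>|M. x \<bullet> (matrix_inv (P k \<omega>) *v x)) \<le> x \<bullet> (matrix_inv (L k) *v x)" for k x
  proof (induction k arbitrary: x)
    case 0
    then show ?case
      by (simp add: P_def L_def prob_space)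
  next
    case (Suc k)
    \<comment> \<open>One minimizer, chosen for the deterministic \<open>L k\<close>, serves as a trial vector for all \<open>P k \<omega>\<close>.\<close>
    obtain v where v: "x \<bullet> (pred (L k) *v x)
        = (x - A *v v) \<bullet> (matrix_inv Q *v (x - A *v v)) + v \<bullet> (matrix_inv (L k) *v v)"
      unfolding pred_def using predicted_info_attained[OF L_pd Q] .
    have "(LINT \<omega>|M. x \<bullet> (pred (P k \<omega>) *v x))
        \<le> (LINT \<omega>|M. (x - A *v v) \<bullet> (matrix_inv Q *v (x - A *v v)) + v \<bullet> (matrix_inv (P k \<omega>) *v v))"
      by (intro integral_mono form_int Bochner_Integration.integrable_add integrable_const)
         (simp_all add: pred_def predicted_info_le[OF P_pd Q])
    also have "\<dots> = (x - A *v v) \<bullet> (matrix_inv Q *v (x - A *v v))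
        + (LINT \<omega>|M. v \<bullet> (matrix_inv (P k \<omega>) *v v))"
      using form_int[of v matrix_inv k] by (simp add: prob_space)
    also have "\<dots> \<le> x \<bullet> (pred (L k) *v x)"
      using Suc.IH[of v] by (simp add: v)
    finally have pred_le: "(LINT \<omega>|M. x \<bullet> (pred (P k \<omega>) *v x)) \<le> x \<bullet> (pred (L k) *v x)" .
    have "(LINT \<omega>|M. x \<bullet> (matrix_inv (P (Suc k) \<omega>) *v x))
        = (LINT \<omega>|M. x \<bullet> (pred (P k \<omega>) *v x) + x \<bullet> (J (Suc k) \<omega> *v x))"
    proof (rule Bochner_Integration.integral_cong)
      fix \<omega> assume "\<omega> \<in> space M"
      then have "matrix_inv (P (Suc k) \<omega>) = pred (P k \<omega>) + J (Suc k) \<omega>"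
        unfolding P_def pred_def by (intro matrix_inv_riccati_Suc[OF Q S] psd)
      then show "x \<bullet> (matrix_inv (P (Suc k) \<omega>) *v x)
          = x \<bullet> (pred (P k \<omega>) *v x) + x \<bullet> (J (Suc k) \<omega> *v x)"
        by (simp add: matrix_vector_mult_add_rdistrib inner_add_right)
    qed simp
    also have "\<dots> = (LINT \<omega>|M. x \<bullet> (pred (P k \<omega>) *v x)) + x \<bullet> ((LINT \<omega>|M. J (Suc k) \<omega>) *v x)"
      using form_int[of x pred k] integrable_matrix_form[OF J_int[of "Suc k"], of x x]
      by (simp add: integral_matrix_form[OF J_int])
    also have "\<dots> \<le> x \<bullet> (pred (L k) *v x) + x \<bullet> ((LINT \<omega>|M. J (Suc k) \<omega>) *v x)"
      using pred_le by simp
    also have "\<dots> = x \<bullet> (matrix_inv (L (Suc k)) *v x)"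
      unfolding L_def pred_def
      by (subst matrix_inv_riccati_Suc[OF Q S mean_psd])
         (simp_all add: matrix_vector_mult_add_rdistrib inner_add_right)
    finally show ?case .
  qed
  then show ?thesis
    by (simp add: P_def L_def)
qed

text \<open>
  Duality with the trial vector \<open>L x\<close>, where \<open>L\<close> is the recursion driven by the means, bounds
  \<open>x'Px\<close> from below by an affine function of \<open>P\<inverse>\<close>, and the mean of \<open>P\<inverse>\<close> is at most \<open>L\<inverse>\<close>.
\<close>
lemma riccati_mean_le_expectation:
  fixes J :: "nat \<Rightarrow> 'w \<Rightarrow> real^'n^'n"
  assumes "prob_space M" and Q: "pos_def Q" and S: "pos_def S"
    and simple: "\<And>k. k \<ge> 1 \<Longrightarrow> simple_function M (J k)"
    and psd: "\<And>k \<omega>. k \<ge> 1 \<Longrightarrow> \<omega> \<in> space M \<Longrightarrow> pos_semidef (J k \<omega>)"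
  shows "riccati A Q S (\<lambda>j. LINT \<omega>|M. J j \<omega>) k
    \<preceq>\<^sub>L (LINT \<omega>|M. riccati A Q S (\<lambda>j. J j \<omega>) k)"
proof -
  interpret prob_space M by fact
  define P where "P \<omega> = riccati A Q S (\<lambda>j. J j \<omega>) k" for \<omega>
  define L where "L = riccati A Q S (\<lambda>j. LINT \<omega>|M. J j \<omega>) k"
  have mean_psd: "pos_semidef (LINT \<omega>|M. J k \<omega>)" if "k \<ge> 1" for k
    using pos_semidef_integral[OF integrable_simple_function[OF simple[OF that]]] psd[OF that]
    by blast
  have L_pd: "pos_def L"
    unfolding L_def by (rule pos_def_riccati[OF Q S mean_psd])
  have P_pd: "pos_def (P \<omega>)" if "\<omega> \<in> space M" for \<omega>
    unfolding P_def using that by (intro pos_def_riccati[OF Q S] psd)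
  have P_simple: "simple_function M P"
    unfolding P_def by (rule simple_function_riccati[OF simple])
  have P_int: "integrable M P"
    by (rule integrable_simple_function[OF P_simple])
  have inv_int: "integrable M (\<lambda>\<omega>. v \<bullet> (matrix_inv (P \<omega>) *v v))" for v
    by (intro integrable_matrix_form integrable_simple_function simple_function_compose1[OF P_simple])
  have "x \<bullet> (L *v x) \<le> x \<bullet> ((LINT \<omega>|M. P \<omega>) *v x)" for x
  proof -
    define v where "v = L *v x"
    have "(LINT \<omega>|M. v \<bullet> (matrix_inv (P \<omega>) *v v)) \<le> v \<bullet> (matrix_inv L *v v)"
      unfolding P_def L_def by (rule expected_info_le[OF assms])
    also have "\<dots> = v \<bullet> x"
      by (simp add: v_def pos_def_inv_cancel[OF L_pd])
    finally have "x \<bullet> (L *v x) \<le> 2 * (v \<bullet> x) - (LINT \<omega>|M. v \<bullet> (matrix_inv (P \<omega>) *v v))"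
      by (simp add: v_def inner_commute)
    also have "\<dots> = (LINT \<omega>|M. 2 * (v \<bullet> x) - v \<bullet> (matrix_inv (P \<omega>) *v v))"
      using inv_int[of v] by (simp add: prob_space)
    also have "\<dots> \<le> (LINT \<omega>|M. x \<bullet> (P \<omega> *v x))"
    proof (intro integral_mono integrable_matrix_form[OF P_int] Bochner_Integration.integrable_diff
        integrable_const inv_int)
      fix \<omega> assume "\<omega> \<in> space M"
      from P_pd[OF this] show "2 * (v \<bullet> x) - v \<bullet> (matrix_inv (P \<omega>) *v v) \<le> x \<bullet> (P \<omega> *v x)"
        using inverse_form_ge[OF pos_def_matrix_inv, of "P \<omega>" v x]
        by (simp add: matrix_inv_matrix_inv)
    qed
    also have "\<dots> = x \<bullet> ((LINT \<omega>|M. P \<omega>) *v x)"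
      by (rule integral_matrix_form[OF P_int, symmetric])
    finally show ?thesis .
  qed
  moreover have "transpose ((LINT \<omega>|M. P \<omega>) - L) = (LINT \<omega>|M. P \<omega>) - L"
  proof -
    have "transpose ((LINT \<omega>|M. P \<omega>) - L) = transpose (LINT \<omega>|M. P \<omega>) - transpose L"
      by (simp add: transpose_def vec_eq_iff)
    moreover have "transpose (LINT \<omega>|M. P \<omega>) = (LINT \<omega>|M. P \<omega>)"
      using P_pd by (intro transpose_integral[OF P_int]) (simp add: pos_def_def)
    ultimately show ?thesis
      using L_pd by (simp add: pos_def_def)
  qed
  ultimately have "pos_semidef ((LINT \<omega>|M. P \<omega>) - L)"
    by (simp add: pos_semidef_def matrix_vector_mult_diff_rdistrib inner_diff_right)
  then show ?thesis
    by (simp add: loewner_le_def P_def L_def)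
qed

section \<open>Information gained from a random tree\<close>

lemma prob_sensor_selected:
  fixes G :: "'m::finite node pair_pre_digraph"
  assumes "prob_space M" and T: "T \<in> measurable M (count_space (fc_subtrees G))"
    and \<pi>: "\<And>t. t \<in> fc_subtrees G \<Longrightarrow> measure M {\<omega> \<in> space M. T \<omega> = t} = \<pi> k t"
  shows "measure M {\<omega> \<in> space M. Sensor i \<in> pverts (T \<omega>)} = selection_prob G \<pi> k i"
proof -
  interpret prob_space M by fact
  let ?S = "{t \<in> fc_subtrees G. Sensor i \<in> pverts t}"
  have "{\<omega> \<in> space M. Sensor i \<in> pverts (T \<omega>)} = (\<Union>t\<in>?S. {\<omega> \<in> space M. T \<omega> = t})"
    using measurable_space[OF T] by auto
  moreover have "{\<omega> \<in> space M. T \<omega> = t} \<in> sets M" if "t \<in> fc_subtrees G" for t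
    using measurable_sets[OF T, of "{t}"] that by (simp add: vimage_def Int_def conj_commute)
  then have "measure M (\<Union>t\<in>?S. {\<omega> \<in> space M. T \<omega> = t})
      = (\<Sum>t\<in>?S. measure M {\<omega> \<in> space M. T \<omega> = t})"
    using finite_fc_subtrees[of G]
    by (intro finite_measure_finite_Union) (auto simp: disjoint_family_on_def)
  ultimately show ?thesis
    using \<pi> by (simp add: selection_prob_def)
qed

lemma simple_function_tree:
  fixes G :: "'m::finite node pair_pre_digraph"
  assumes T: "T \<in> measurable M (count_space (fc_subtrees G))"
  shows "simple_function M T"
  unfolding simple_function_def
proof
  have "T ` space M \<subseteq> fc_subtrees G"
    using measurable_space[OF T] by auto
  then show "finite (T ` space M)"
    by (rule finite_subset[OF _ finite_fc_subtrees])
  show "\<forall>t\<in>T ` space M. T -` {t} \<inter> space M \<in> sets M"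
    using measurable_space[OF T] by (auto intro!: measurable_sets[OF T])
qed

lemma expected_tree_info:
  fixes G :: "'m::finite node pair_pre_digraph" and C :: "real^'n^'m"
  assumes "prob_space M" and T: "T \<in> measurable M (count_space (fc_subtrees G))"
    and \<pi>: "\<And>t. t \<in> fc_subtrees G \<Longrightarrow> measure M {\<omega> \<in> space M. T \<omega> = t} = \<pi> k t"
  shows "(LINT \<omega>|M. (\<Sum>i \<in> {i. Sensor i \<in> pverts (T \<omega>)}. sensor_info C r i))
    = (\<Sum>i\<in>UNIV. selection_prob G \<pi> k i *\<^sub>R sensor_info C r i)"
proof -
  interpret prob_space M by fact
  define E where "E i = {\<omega> \<in> space M. Sensor i \<in> pverts (T \<omega>)}" for i
  have E_eq: "E i = T -` {t. Sensor i \<in> pverts t} \<inter> space M" for i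
    by (auto simp: E_def)
  have E: "E i \<in> sets M" for i
    unfolding E_eq by (rule simple_functionD(2)[OF simple_function_tree[OF T]])
  have "(LINT \<omega>|M. (\<Sum>i \<in> {i. Sensor i \<in> pverts (T \<omega>)}. sensor_info C r i))
      = (LINT \<omega>|M. (\<Sum>i\<in>UNIV. indicator (E i) \<omega> *\<^sub>R sensor_info C r i))"
  proof (rule Bochner_Integration.integral_cong)
    fix \<omega> assume "\<omega> \<in> space M"
    then show "(\<Sum>i \<in> {i. Sensor i \<in> pverts (T \<omega>)}. sensor_info C r i)
        = (\<Sum>i\<in>UNIV. indicator (E i) \<omega> *\<^sub>R sensor_info C r i)"
      by (intro sum.mono_neutral_cong_left) (auto simp: E_def)
  qed simp
  also have "\<dots> = (\<Sum>i\<in>UNIV. measure M (E i) *\<^sub>R sensor_info C r i)"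
    using E by (subst Bochner_Integration.integral_sum) (simp_all add: less_top[symmetric])
  also have "measure M (E i) = selection_prob G \<pi> k i" for i
    unfolding E_def using assms by (rule prob_sensor_selected[of M T G \<pi> k])
  then have "(\<Sum>i\<in>UNIV. measure M (E i) *\<^sub>R sensor_info C r i)
      = (\<Sum>i\<in>UNIV. selection_prob G \<pi> k i *\<^sub>R sensor_info C r i)"
    by simp
  finally show ?thesis .
qed

lemma riccati_cong:
  assumes "\<And>k. k \<ge> 1 \<Longrightarrow> J k = J' k"
  shows "riccati A Q S J k = riccati A Q S J' k"
  using assms by (induction k) auto

theorem theorem2:
  fixes A Q \<Sigma> :: "real^'n^'n" and C :: "real^'n^'m" and r :: "'m \<Rightarrow> real"
    and G :: "'m node pair_pre_digraph"
    and \<pi> :: "nat \<Rightarrow> 'm node pair_pre_digraph \<Rightarrow> real"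
    and M :: "'w measure"
    and tree_sel :: "nat \<Rightarrow> 'w \<Rightarrow> 'm node pair_pre_digraph"
  assumes "pos_def Q" and "pos_def \<Sigma>"
    and "observable C A"
    and "\<And>i. r i > 0"
    and "sensor_tree G"
    and "\<And>k T. k \<ge> 1 \<Longrightarrow> T \<in> fc_subtrees G \<Longrightarrow> \<pi> k T \<ge> 0"
    and "\<And>k. k \<ge> 1 \<Longrightarrow> (\<Sum>T\<in>fc_subtrees G. \<pi> k T) = 1"
    and "prob_space M"
    and "\<And>k. k \<ge> 1 \<Longrightarrow> tree_sel k \<in> measurable M (count_space (fc_subtrees G))"
    and "\<And>k T. k \<ge> 1 \<Longrightarrow> T \<in> fc_subtrees G \<Longrightarrow>
           measure M {\<omega> \<in> space M. tree_sel k \<omega> = T} = \<pi> k T"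
  shows "\<forall>k. lower_cov A Q \<Sigma> C r (selection_prob G \<pi>) k
             \<preceq>\<^sub>L (LINT \<omega>|M. error_cov A Q \<Sigma> C r (\<lambda>j. tree_sel j \<omega>) k)"
proof
  fix k
  define J where "J k \<omega> = (\<Sum>i \<in> {i. Sensor i \<in> pverts (tree_sel k \<omega>)}. sensor_info C r i)" for k \<omega>
  have mean: "(LINT \<omega>|M. J k \<omega>) = (\<Sum>i\<in>UNIV. selection_prob G \<pi> k i *\<^sub>R sensor_info C r i)"
    if "k \<ge> 1" for k
    unfolding J_def using assms(9)[OF that] assms(10)[OF that]
    by (rule expected_tree_info[OF assms(8)])
  have "riccati A Q \<Sigma> (\<lambda>j. LINT \<omega>|M. J j \<omega>) k \<preceq>\<^sub>L (LINT \<omega>|M. riccati A Q \<Sigma> (\<lambda>j. J j \<omega>) k)"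
  proof (rule riccati_mean_le_expectation[OF assms(8,1,2)])
    show "simple_function M (J k)" if "k \<ge> 1" for k
      unfolding J_def by (rule simple_function_compose1[OF simple_function_tree[OF assms(9)[OF that]]])
    show "pos_semidef (J k \<omega>)" for k \<omega>
      unfolding J_def by (intro pos_semidef_sum pos_semidef_sensor_info assms(4))
  qed
  moreover have "riccati A Q \<Sigma> (\<lambda>j. LINT \<omega>|M. J j \<omega>) k = lower_cov A Q \<Sigma> C r (selection_prob G \<pi>) k"
    unfolding lower_cov_def using mean by (rule riccati_cong)
  ultimately show "lower_cov A Q \<Sigma> C r (selection_prob G \<pi>) k
      \<preceq>\<^sub>L (LINT \<omega>|M. error_cov A Q \<Sigma> C r (\<lambda>j. tree_sel j \<omega>) k)"
    by (simp add: error_cov_def J_def)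
qed

end
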